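(* Let $n=1$, let $\alpha$ satisfy Hypothesis (H) of the context, let $g:[0,\infty)\to\mathbb{R}$ be continuous and of at most polynomial growth, and let $u$ be the solution of the Black-Scholes equation with initial condition $g$ (as defined in the context). Assume that there is a constant $C$ such that $a(x,t)\le Cx^2$ for all $x$ and $t$. Assume also that the (one-sided) derivative $g'(0)$ of $g$ at $x=0$ exists. Then for all $t\ge 0$ the (one-sided) spatial derivative $u_x(x,t)$ exists at $x=0$, and $$u_x(0,t)=g'(0)\qquad\text{for all } t\ge 0.$$
   Context: Fix $T\in\mathbb{R}$. Hypothesis (H) (for $n=1$). The real-valued function $\alpha=\alpha(x,t)$ is defined on $[0,\infty)\times(-\infty,T]$ and: (i) $\alpha$ is continuous in the time variable, and is Hölder continuous with exponent $1/2$ (for instance Lipschitz continuous) in the spatial variable on every compact subset of $(0,\infty)\times(-\infty,T]$; moreover $|\alpha(x,t)|\le K(1+x)$ for some constant $K$; (ii) $\alpha(0,t)=0$ for all $t$; (iii) $\alpha(x,t)\ne 0$ for all $x>0$ and all $t$. Discontinuities of $\alpha$ at $x=0$ are allowed. For $t\ge 0$ set $a(x,t):=\tfrac12\alpha(x,T-t)^2$. Black-Scholes equation. $u$ is the unique classical solution of at most polynomial growth (i.e. continuous on $[0,\infty)\times[0,\infty)$, twice continuously differentiable in $x$ and once in $t$ on $(0,\infty)\times(0,\infty)$, and of at most polynomial growth in $x$ uniformly on bounded time intervals) of $$a(x,t)u_{xx}-u_t=0\ \text{ in }(0,\infty)\times(0,\infty),\qquad u(x,0)=g(x),\qquad u(0,t)=g(0)\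 \text{ for } t\ge 0.$$ Existence and uniqueness of this solution are known. *)

theory Defs
  imports "HOL-Analysis.Analysis"
begin

(* Functions on [0,\<infinity>) or on a product of intervals are total functions on the reals;
   only their values on the stated domain matter. *)

definition hypothesis_H :: "real \<Rightarrow> (real \<Rightarrow> real \<Rightarrow> real) \<Rightarrow> bool" where
  "hypothesis_H T \<alpha> \<longleftrightarrow>
     (\<forall>x\<ge>0. continuous_on {..T} (\<lambda>t. \<alpha> x t)) \<and>
     (\<forall>S. compact S \<and> S \<subseteq> {0<..} \<times> {..T} \<longrightarrow>
        (\<exists>L. \<forall>x y t. (x, t) \<in> S \<and> (y, t) \<in> S \<longrightarrow> \<bar>\<alpha> x t - \<alpha> y t\<bar> \<le> L * sqrt \<bar>x - y\<bar>)) \<and>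
     (\<exists>K. \<forall>x\<ge>0. \<forall>t\<le>T. \<bar>\<alpha> x t\<bar> \<le> K * (1 + x)) \<and>
     (\<forall>t\<le>T. \<alpha> 0 t = 0) \<and>
     (\<forall>x>0. \<forall>t\<le>T. \<alpha> x t \<noteq> 0)"

definition diffusion_coeff :: "real \<Rightarrow> (real \<Rightarrow> real \<Rightarrow> real) \<Rightarrow> real \<Rightarrow> real \<Rightarrow> real" where
  "diffusion_coeff T \<alpha> x t = (1/2) * (\<alpha> x (T - t))\<^sup>2"

definition polynomial_growth :: "(real \<Rightarrow> real) \<Rightarrow> bool" where
  "polynomial_growth f \<longleftrightarrow> (\<exists>M. \<exists>m::nat. \<forall>x\<ge>0. \<bar>f x\<bar> \<le> M * (1 + x ^ m))"

(* The constants M and m may depend on the time horizon S. *)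
definition locally_uniform_polynomial_growth :: "(real \<Rightarrow> real \<Rightarrow> real) \<Rightarrow> bool" where
  "locally_uniform_polynomial_growth u \<longleftrightarrow>
     (\<forall>S\<ge>0. \<exists>M. \<exists>m::nat. \<forall>x\<ge>0. \<forall>t\<in>{0..S}. \<bar>u x t\<bar> \<le> M * (1 + x ^ m))"

(* ux, uxx and ut are the partial derivatives of u; "continuously" means jointly in (x,t). *)
definition black_scholes_solution ::
  "(real \<Rightarrow> real \<Rightarrow> real) \<Rightarrow> (real \<Rightarrow> real) \<Rightarrow> (real \<Rightarrow> real \<Rightarrow> real) \<Rightarrow> bool" where
  "black_scholes_solution a g u \<longleftrightarrow>
     continuous_on ({0..} \<times> {0..}) (\<lambda>(x, t). u x t) \<and>
     (\<exists>ux uxx ut.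
        (\<forall>x>0. \<forall>t>0.
           ((\<lambda>y. u y t) has_real_derivative ux x t) (at x) \<and>
           ((\<lambda>y. ux y t) has_real_derivative uxx x t) (at x) \<and>
           ((\<lambda>s. u x s) has_real_derivative ut x t) (at t) \<and>
           a x t * uxx x t - ut x t = 0) \<and>
        continuous_on ({0<..} \<times> {0<..}) (\<lambda>(x, t). ux x t) \<and>
        continuous_on ({0<..} \<times> {0<..}) (\<lambda>(x, t). uxx x t) \<and>
        continuous_on ({0<..} \<times> {0<..}) (\<lambda>(x, t). ut x t)) \<and>
     locally_uniform_polynomial_growth u \<and>
     (\<forall>x\<ge>0. u x 0 = g x) \<and>
     (\<forall>t\<ge>0. u 0 t = g 0)"

end

theory Submission
  imports Defs
begin

text \<open>
  After subtracting the affine function \<open>g 0 + g'0 * x\<close>, which solves the equation, the claim is that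
  \<open>v x t = o(x)\<close>. For \<open>\<epsilon> > 0\<close> the function \<open>\<epsilon> * x + B * x\<^sup>2 * exp (l * t)\<close> is a strict
  supersolution for \<open>l = 2 * C + 1\<close>, because \<open>a x t \<le> C * x\<^sup>2\<close>. On a small rectangle
  \<open>{0..d} \<times> {0..S}\<close> it dominates \<open>v\<close> and \<open>-v\<close> on the parabolic boundary: at \<open>t = 0\<close> through the
  term \<open>\<epsilon> * x\<close>, and at \<open>x = d\<close> through a large \<open>B\<close>. The maximum principle on the rectangle gives
  \<open>\<bar>v x t\<bar> \<le> \<epsilon> * x + O(x\<^sup>2)\<close>.
\<close>

text \<open>If \<open>D\<close> were negative, \<open>f'\<close>, which vanishes at the minimum
  \<open>x\<close>, would be negative just to the right of \<open>x\<close>; by the mean value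
  theorem \<open>f\<close> would then fall below \<open>f x\<close>.\<close>

lemma second_derivative_nonneg_at_min:
  fixes f :: "real \<Rightarrow> real"
  assumes "a < x" "x < b"
    and f': "\<And>y. a < y \<Longrightarrow> y < b \<Longrightarrow> (f has_real_derivative f' y) (at y)"
    and f'': "(f' has_real_derivative D) (at x)"
    and min: "\<And>y. a < y \<Longrightarrow> y < b \<Longrightarrow> f x \<le> f y"
  shows "D \<ge> 0"
proof (rule ccontr)
  assume "\<not> D \<ge> 0"
  then obtain d where d: "d > 0" "\<And>h. 0 < h \<Longrightarrow> h < d \<Longrightarrow> f' (x + h) < f' x"
    using has_real_derivative_neg_dec_right[OF f''] by auto
  have "f' x = 0"
  proof (rule DERIV_local_min)
    show "(f has_real_derivative f' x) (at x)"
      using assms by blast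
    show "0 < min (x - a) (b - x)"
      using assms by simp
    show "\<forall>y. \<bar>x - y\<bar> < min (x - a) (b - x) \<longrightarrow> f x \<le> f y"
      using min by (auto simp: abs_less_iff)
  qed
  define h where "h = min d (b - x) / 2"
  have h: "0 < h" "h < d" "x + h < b"
    using d assms by (auto simp: h_def min_def field_simps)
  obtain z where z: "x < z" "z < x + h" "f (x + h) - f x = (x + h - x) * f' z"
    using MVT2[of x "x + h" f f'] f' h assms by auto
  have "f' z < 0"
    using d(2)[of "z - x"] z h \<open>f' x = 0\<close> by auto
  then have "f (x + h) < f x"
    using z(3) mult_pos_neg[OF h(1), of "f' z"] by simp
  moreover have "f x \<le> f (x + h)"
    using min h assms by auto
  ultimately show False
    by simp
qed

text \<open>A negative minimum over the compact rectangle cannot lie on the left, right or bottom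
  side. At such a point \<open>zxx\<close> is nonnegative and \<open>zt\<close> is nonpositive,
  which contradicts the strict inequality \<open>super\<close>. The top side \<open>t = S\<close> is
  not excluded, so the differential inequality is required there as well.\<close>

lemma parabolic_minimum_principle:
  fixes z :: "real \<Rightarrow> real \<Rightarrow> real"
  assumes cont: "continuous_on ({0..d} \<times> {0..S}) (\<lambda>(x, t). z x t)"
    and zx: "\<And>x t. 0 < x \<Longrightarrow> x < d \<Longrightarrow> 0 < t \<Longrightarrow> t \<le> S \<Longrightarrow>
      ((\<lambda>y. z y t) has_real_derivative zx x t) (at x)"
    and zxx: "\<And>x t. 0 < x \<Longrightarrow> x < d \<Longrightarrow> 0 < t \<Longrightarrow> t \<le> S \<Longrightarrow>
      ((\<lambda>y. zx y t) has_real_derivative zxx x t) (at x)"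
    and zt: "\<And>x t. 0 < x \<Longrightarrow> x < d \<Longrightarrow> 0 < t \<Longrightarrow> t \<le> S \<Longrightarrow>
      ((\<lambda>s. z x s) has_real_derivative zt x t) (at t)"
    and a: "\<And>x t. 0 < x \<Longrightarrow> x < d \<Longrightarrow> 0 < t \<Longrightarrow> t \<le> S \<Longrightarrow> 0 \<le> a x t"
    and super: "\<And>x t. 0 < x \<Longrightarrow> x < d \<Longrightarrow> 0 < t \<Longrightarrow> t \<le> S \<Longrightarrow>
      a x t * zxx x t - zt x t < 0"
    and left: "\<And>t. 0 \<le> t \<Longrightarrow> t \<le> S \<Longrightarrow> 0 \<le> z 0 t"
    and right: "\<And>t. 0 \<le> t \<Longrightarrow> t \<le> S \<Longrightarrow> 0 \<le> z d t"
    and bottom: "\<And>x. 0 \<le> x \<Longrightarrow> x \<le> d \<Longrightarrow> 0 \<le> z x 0"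
    and xt: "0 \<le> x" "x \<le> d" "0 \<le> t" "t \<le> S"
  shows "0 \<le> z x t"
proof (rule ccontr)
  assume neg: "\<not> 0 \<le> z x t"
  have "compact ({0..d} \<times> {0..S})" "{0..d} \<times> {0..S} \<noteq> {}"
    using xt by (auto intro: compact_Times)
  from continuous_attains_inf[OF this cont] obtain p0 where
    p0: "p0 \<in> {0..d} \<times> {0..S}" "\<forall>p\<in>{0..d} \<times> {0..S}. z (fst p0) (snd p0) \<le> z (fst p) (snd p)"
    by (auto simp: case_prod_beta)
  define x0 t0 where "x0 = fst p0" and "t0 = snd p0"
  have rect: "0 \<le> x0" "x0 \<le> d" "0 \<le> t0" "t0 \<le> S"
    using p0(1) by (auto simp: x0_def t0_def)
  have min: "z x0 t0 \<le> z y s" if "0 \<le> y" "y \<le> d" "0 \<le> s" "s \<le> S" for y s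
    using p0(2) that by (force simp: x0_def t0_def)
  have "z x0 t0 < 0"
    using min[OF xt] neg by simp
  then have "x0 \<noteq> 0" "x0 \<noteq> d" "t0 \<noteq> 0"
    using left[of t0] right[of t0] bottom[of x0] rect by auto
  then have int: "0 < x0" "x0 < d" "0 < t0"
    using rect by auto
  have "0 \<le> zxx x0 t0"
    by (rule second_derivative_nonneg_at_min[of 0 x0 d "\<lambda>y. z y t0" "\<lambda>y. zx y t0"])
      (use int rect min zx zxx in auto)
  \<comment> \<open>Only earlier times \<open>t0 - h\<close> are compared, since
    \<open>t0 = S\<close> is possible and later times may leave the rectangle.\<close>
  moreover have "zt x0 t0 \<le> 0"
  proof (rule ccontr)
    assume "\<not> zt x0 t0 \<le> 0"
    then obtain e where e: "e > 0" "\<And>h. 0 < h \<Longrightarrow> h < e \<Longrightarrow> z x0 (t0 - h) < z x0 t0"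
      using has_real_derivative_pos_inc_left[OF zt[of x0 t0]] int rect by auto
    define h where "h = min e t0 / 2"
    have "0 < h" "h < e" "h \<le> t0"
      using e int by (auto simp: h_def min_def field_simps)
    then show False
      using e(2)[of h] min[of x0 "t0 - h"] rect by auto
  qed
  ultimately have "0 \<le> a x0 t0 * zxx x0 t0 - zt x0 t0"
    using a[of x0 t0] int rect by (smt (verit) mult_nonneg_nonneg)
  then show False
    using super[of x0 t0] int rect by auto
qed

text \<open>Comparison with the barrier keeps the slope \<open>\<epsilon>\<close> of the initial
  bound unchanged up to time \<open>S\<close>; the whole loss is quadratic in \<open>x\<close>. The
  constant \<open>B\<close> may depend on \<open>\<epsilon>\<close>, \<open>d\<close>,
  \<open>S\<close> and \<open>v\<close>, which is harmless near \<open>x = 0\<close>.\<close>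

lemma degenerate_parabolic_upper_bound:
  fixes v :: "real \<Rightarrow> real \<Rightarrow> real"
  assumes cont: "continuous_on ({0..d} \<times> {0..S}) (\<lambda>(x, t). v x t)"
    and vx: "\<And>x t. 0 < x \<Longrightarrow> 0 < t \<Longrightarrow> ((\<lambda>y. v y t) has_real_derivative vx x t) (at x)"
    and vxx: "\<And>x t. 0 < x \<Longrightarrow> 0 < t \<Longrightarrow> ((\<lambda>y. vx y t) has_real_derivative vxx x t) (at x)"
    and vt: "\<And>x t. 0 < x \<Longrightarrow> 0 < t \<Longrightarrow> ((\<lambda>s. v x s) has_real_derivative vt x t) (at t)"
    and pde: "\<And>x t. 0 < x \<Longrightarrow> 0 < t \<Longrightarrow> a x t * vxx x t = vt x t"
    and a: "\<And>x t. 0 < x \<Longrightarrow> 0 < t \<Longrightarrow> 0 \<le> a x t \<and> a x t \<le> C * x\<^sup>2"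
    and left: "\<And>t. 0 \<le> t \<Longrightarrow> v 0 t \<le> 0"
    and bottom: "\<And>x. 0 \<le> x \<Longrightarrow> x \<le> d \<Longrightarrow> v x 0 \<le> \<epsilon> * x"
    and "0 < d" "0 \<le> S" "0 \<le> \<epsilon>"
  obtains B where "0 < B"
    and "\<And>x. 0 \<le> x \<Longrightarrow> x \<le> d \<Longrightarrow> v x S \<le> \<epsilon> * x + B * x\<^sup>2"
proof -
  have "0 \<le> C"
    using a[of 1 1] by simp
  have "compact ({0..d} \<times> {0..S})"
    by (auto intro: compact_Times)
  from compact_imp_bounded[OF compact_continuous_image[OF cont this]]
  obtain M where "M > 0" and "\<forall>y\<in>(\<lambda>(x, t). v x t) ` ({0..d} \<times> {0..S}). norm y \<le> M"
    unfolding bounded_pos by blast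
  then have M: "\<bar>v x t\<bar> \<le> M" if "0 \<le> x" "x \<le> d" "0 \<le> t" "t \<le> S" for x t
    using that by auto
  \<comment> \<open>With this choice the quadratic term is at least \<open>M\<close> at
    \<open>x = d\<close>, because \<open>exp (l * t)\<close> is at least 1 for
    \<open>t \<ge> 0\<close>.\<close>
  define B where "B = M / d\<^sup>2"
  have "B > 0" and B: "B * d\<^sup>2 = M"
    using \<open>M > 0\<close> \<open>0 < d\<close> by (auto simp: B_def)
  \<comment> \<open>The diffusion term of the barrier is at most
    \<open>2 * C * B * x\<^sup>2 * exp (l * t)\<close>, and its time derivative has the factor
    \<open>l\<close> in place of \<open>2 * C\<close>. The extra 1 makes the supersolution
    strict.\<close>
  define l where "l = 2 * C + 1"
  have "l \<ge> 0"
    using \<open>0 \<le> C\<close> by (simp add: l_def)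
  define z where "z x t = \<epsilon> * x + B * x\<^sup>2 * exp (l * t) - v x t" for x t
  have z_nonneg: "0 \<le> z x t" if "0 \<le> x" "x \<le> d" "0 \<le> t" "t \<le> S" for x t
  proof (rule parabolic_minimum_principle[of d S z
        "\<lambda>x t. \<epsilon> + B * (2 * x) * exp (l * t) - vx x t"
        "\<lambda>x t. B * 2 * exp (l * t) - vxx x t"
        "\<lambda>x t. B * x\<^sup>2 * (exp (l * t) * l) - vt x t" a])
    show "continuous_on ({0..d} \<times> {0..S}) (\<lambda>(x, t). z x t)"
      using cont unfolding z_def case_prod_beta by (intro continuous_intros)
  next
    fix x t :: real assume "0 < x" "x < d" "0 < t" "t \<le> S"
    then show "((\<lambda>y. z y t) has_real_derivative
        \<epsilon> + B * (2 * x) * exp (l * t) - vx x t) (at x)"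
      unfolding z_def by (auto intro!: derivative_eq_intros vx)
    show "((\<lambda>y. \<epsilon> + B * (2 * y) * exp (l * t) - vx y t) has_real_derivative
        B * 2 * exp (l * t) - vxx x t) (at x)"
      using \<open>0 < x\<close> \<open>0 < t\<close> by (auto intro!: derivative_eq_intros vxx)
    show "((\<lambda>s. z x s) has_real_derivative B * x\<^sup>2 * (exp (l * t) * l) - vt x t) (at t)"
      using \<open>0 < x\<close> \<open>0 < t\<close> unfolding z_def by (auto intro!: derivative_eq_intros vt)
    show "0 \<le> a x t"
      using a \<open>0 < x\<close> \<open>0 < t\<close> by blast
    have E: "0 < B * exp (l * t)"
      using \<open>B > 0\<close> by simp
    have "a x t * (B * exp (l * t)) \<le> (C * x\<^sup>2) * (B * exp (l * t))"
      using a[OF \<open>0 < x\<close> \<open>0 < t\<close>] E by (intro mult_right_mono) auto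
    moreover have "0 < x\<^sup>2 * (B * exp (l * t))"
      using E \<open>0 < x\<close> by simp
    ultimately show "a x t * (B * 2 * exp (l * t) - vxx x t)
        - (B * x\<^sup>2 * (exp (l * t) * l) - vt x t) < 0"
      using pde[OF \<open>0 < x\<close> \<open>0 < t\<close>] by (simp add: l_def algebra_simps)
  next
    fix t assume "0 \<le> t" "t \<le> S"
    then show "0 \<le> z 0 t"
      using left by (simp add: z_def)
    have "M * 1 \<le> M * exp (l * t)"
      using \<open>M > 0\<close> \<open>l \<ge> 0\<close> \<open>0 \<le> t\<close> by (intro mult_left_mono) auto
    moreover have "v d t \<le> M" "0 \<le> \<epsilon> * d"
      using M[of d t] \<open>0 \<le> t\<close> \<open>t \<le> S\<close> \<open>0 < d\<close> \<open>0 \<le> \<epsilon>\<close> by auto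
    ultimately show "0 \<le> z d t"
      unfolding z_def B by simp
  next
    fix x assume "0 \<le> x" "x \<le> d"
    then show "0 \<le> z x 0"
      using bottom[of x] \<open>B > 0\<close> unfolding z_def
      by (smt (verit) mult_nonneg_nonneg exp_ge_zero zero_le_power2)
  qed (use that in auto)
  show thesis
  proof (rule that)
    \<comment> \<open>The bound is wanted at the single time \<open>S\<close>, so the exponential is
      absorbed into the constant.\<close>
    show "0 < B * exp (l * S)"
      using \<open>B > 0\<close> by simp
    show "v x S \<le> \<epsilon> * x + B * exp (l * S) * x\<^sup>2" if "0 \<le> x" "x \<le> d" for x
      using z_nonneg[OF that \<open>0 \<le> S\<close> order_refl] by (simp add: z_def algebra_simps)
  qed
qed

theorem theorem2p3:
  fixes T C g'0 :: real
    and \<alpha> u :: "real \<Rightarrow> real \<Rightarrow> real"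
    and g :: "real \<Rightarrow> real"
  assumes "hypothesis_H T \<alpha>"
    and "continuous_on {0..} g"
    and "polynomial_growth g"
    and "black_scholes_solution (diffusion_coeff T \<alpha>) g u"
    and "\<And>x t. x \<ge> 0 \<Longrightarrow> t \<ge> 0 \<Longrightarrow> diffusion_coeff T \<alpha> x t \<le> C * x\<^sup>2"
    and "(g has_real_derivative g'0) (at 0 within {0..})"
  shows "\<forall>t\<ge>0. ((\<lambda>x. u x t) has_real_derivative g'0) (at 0 within {0..})"
proof (intro allI impI)
  \<comment> \<open>The time at which the derivative is computed serves as the top of the
    rectangle.\<close>
  fix S :: real assume "S \<ge> 0"
  let ?a = "diffusion_coeff T \<alpha>"
  have a: "0 \<le> ?a x t \<and> ?a x t \<le> C * x\<^sup>2" if "0 < x" "0 < t" for x t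
    using assms(5)[of x t] that by (simp add: diffusion_coeff_def)
  from assms(4) have cont: "continuous_on ({0..} \<times> {0..}) (\<lambda>(x, t). u x t)"
    and u0: "\<And>x. x \<ge> 0 \<Longrightarrow> u x 0 = g x" and left: "\<And>t. t \<ge> 0 \<Longrightarrow> u 0 t = g 0"
    unfolding black_scholes_solution_def by auto
  obtain ux uxx ut where "\<forall>x>0. \<forall>t>0.
      ((\<lambda>y. u y t) has_real_derivative ux x t) (at x) \<and>
      ((\<lambda>y. ux y t) has_real_derivative uxx x t) (at x) \<and>
      ((\<lambda>s. u x s) has_real_derivative ut x t) (at t) \<and>
      ?a x t * uxx x t - ut x t = 0"
    using assms(4) unfolding black_scholes_solution_def by (elim conjE exE) (rule that)
  then have ux: "((\<lambda>y. u y t) has_real_derivative ux x t) (at x)"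
    and uxx: "((\<lambda>y. ux y t) has_real_derivative uxx x t) (at x)"
    and ut: "((\<lambda>s. u x s) has_real_derivative ut x t) (at t)"
    and pde: "?a x t * uxx x t = ut x t" if "0 < x" "0 < t" for x t
    using that by simp_all
  have "\<exists>d>0. \<forall>x\<in>{0..}. norm (x - 0) < d \<longrightarrow>
      norm (u x S - u 0 S - g'0 * (x - 0)) \<le> e * norm (x - 0)" if "e > 0" for e
  proof -
    \<comment> \<open>One half of \<open>e\<close> is spent on the initial datum, the other half on
      the quadratic error.\<close>
    have "e / 2 > 0"
      using that by simp
    then obtain d0 where "d0 > 0" and "\<forall>x\<in>{0..}. norm (x - 0) < d0 \<longrightarrow>
        norm (g x - g 0 - g'0 * (x - 0)) \<le> e / 2 * norm (x - 0)"
      using assms(6) unfolding has_field_derivative_def has_derivative_within_alt by blast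
    then have d0: "\<bar>g x - g 0 - g'0 * x\<bar> \<le> e / 2 * x" if "0 \<le> x" "x < d0" for x
      using that by auto
    \<comment> \<open>The estimate for \<open>g\<close> holds for \<open>x < d0\<close> only;
      halving makes it valid on the closed interval up to \<open>d\<close>.\<close>
    define d where "d = d0 / 2"
    have "d > 0" "d < d0"
      using \<open>d0 > 0\<close> by (auto simp: d_def)
    have cont': "continuous_on ({0..d} \<times> {0..S}) (\<lambda>p. u (fst p) (snd p))"
      using continuous_on_subset[OF cont, of "{0..d} \<times> {0..S}"]
      by (simp add: case_prod_beta subset_iff)
    \<comment> \<open>The factor \<open>\<sigma>\<close> treats both signs at once: the equation is
      linear, and the subtracted affine function has zero second and time derivatives.\<close>
    have upper: "\<exists>B>0. \<forall>x. 0 \<le> x \<longrightarrow> x \<le> d \<longrightarrow>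
        \<sigma> * (u x S - g 0 - g'0 * x) \<le> e / 2 * x + B * x\<^sup>2" if \<sigma>: "\<bar>\<sigma>\<bar> = 1" for \<sigma> :: real
    proof (rule degenerate_parabolic_upper_bound[of d S "\<lambda>x t. \<sigma> * (u x t - g 0 - g'0 * x)"
          "\<lambda>x t. \<sigma> * (ux x t - g'0)" "\<lambda>x t. \<sigma> * uxx x t" "\<lambda>x t. \<sigma> * ut x t" ?a C "e / 2"])
      show "continuous_on ({0..d} \<times> {0..S}) (\<lambda>(x, t). \<sigma> * (u x t - g 0 - g'0 * x))"
        using cont' unfolding case_prod_beta by (intro continuous_intros)
    next
      fix x t :: real assume "0 < x" "0 < t"
      then show "((\<lambda>y. \<sigma> * (u y t - g 0 - g'0 * y)) has_real_derivative
          \<sigma> * (ux x t - g'0)) (at x)"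
        by (auto intro!: derivative_eq_intros ux)
      show "((\<lambda>y. \<sigma> * (ux y t - g'0)) has_real_derivative \<sigma> * uxx x t) (at x)"
        using \<open>0 < x\<close> \<open>0 < t\<close> by (auto intro!: derivative_eq_intros uxx)
      show "((\<lambda>s. \<sigma> * (u x s - g 0 - g'0 * x)) has_real_derivative \<sigma> * ut x t) (at t)"
        using \<open>0 < x\<close> \<open>0 < t\<close> by (auto intro!: derivative_eq_intros ut)
      show "?a x t * (\<sigma> * uxx x t) = \<sigma> * ut x t"
        using pde[OF \<open>0 < x\<close> \<open>0 < t\<close>] by (simp add: mult.left_commute)
    next
      fix x :: real assume "0 \<le> x" "x \<le> d"
      then have "\<bar>\<sigma> * (u x 0 - g 0 - g'0 * x)\<bar> \<le> e / 2 * x"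
        using d0[of x] \<open>d < d0\<close> u0[of x] \<sigma> by (simp add: abs_mult)
      then show "\<sigma> * (u x 0 - g 0 - g'0 * x) \<le> e / 2 * x"
        by linarith
    qed (use a left \<open>d > 0\<close> \<open>S \<ge> 0\<close> \<open>e > 0\<close> in auto)
    obtain B1 where B1: "B1 > 0"
      "\<And>x. 0 \<le> x \<Longrightarrow> x \<le> d \<Longrightarrow> u x S - g 0 - g'0 * x \<le> e / 2 * x + B1 * x\<^sup>2"
      using upper[of 1] by auto
    obtain B2 where B2: "B2 > 0"
      "\<And>x. 0 \<le> x \<Longrightarrow> x \<le> d \<Longrightarrow> - (u x S - g 0 - g'0 * x) \<le> e / 2 * x + B2 * x\<^sup>2"
      using upper[of "-1"] by auto
    \<comment> \<open>For \<open>x < r\<close> both bounds are available and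
      \<open>(B1 + B2) * x\<close> is at most \<open>e / 2\<close>, so either quadratic term is at
      most \<open>e / 2 * x\<close>.\<close>
    define r where "r = min d (e / (2 * (B1 + B2)))"
    have "r > 0"
      using \<open>d > 0\<close> \<open>e > 0\<close> B1(1) B2(1) by (simp add: r_def)
    moreover have "\<bar>u x S - g 0 - g'0 * x\<bar> \<le> e * x" if "0 \<le> x" "x < r" for x
    proof -
      have "(B1 + B2) * x \<le> e / 2"
        using that B1(1) B2(1) by (simp add: r_def field_simps)
      then have "(B1 + B2) * x * x \<le> e / 2 * x"
        using \<open>0 \<le> x\<close> by (rule mult_right_mono)
      then have "B1 * x\<^sup>2 + B2 * x\<^sup>2 \<le> e / 2 * x"
        by (simp add: power2_eq_square algebra_simps)
      moreover have "0 \<le> B1 * x\<^sup>2" "0 \<le> B2 * x\<^sup>2"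
        using B1(1) B2(1) by auto
      ultimately show ?thesis
        using B1(2)[of x] B2(2)[of x] that by (auto simp: r_def abs_le_iff)
    qed
    \<comment> \<open>The boundary condition turns \<open>g 0\<close> into \<open>u 0 S\<close>, so
      that the estimate concerns an increment of \<open>u\<close> at time \<open>S\<close>.\<close>
    ultimately show ?thesis
      using left[OF \<open>S \<ge> 0\<close>] by (intro exI[of _ r]) auto
  qed
  then show "((\<lambda>x. u x S) has_real_derivative g'0) (at 0 within {0..})"
    unfolding has_field_derivative_def has_derivative_within_alt
    by (auto intro: bounded_linear_mult_right)
qed

end
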